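(* Let $\mathcal{Z}=(\mathcal{Z}_t,t\ge0)$ be a planar Brownian motion starting from $1\in\mathbb{C}$ and let $\vartheta=(\vartheta_t,t\ge0)$ be its continuous winding process around $0$. Then, as $c\to0^+$, the family of processes $$\left(c^{-1/2}\vartheta_{ct},\ t\ge0\right)$$ converges in distribution to a standard one-dimensional Brownian motion $(\gamma_t,t\ge0)$.
   Context: A planar Brownian motion is a process in $\mathbb{C}\cong\mathbb{R}^2$ whose real and imaginary parts are independent standard one-dimensional Brownian motions. Since $\mathcal{Z}$ starts away from $0$, almost surely it never visits $0$, so its winding process is well defined: $\vartheta$ is the continuous process with $\vartheta_0=0$ and $\exp(i\vartheta_t)=\mathcal{Z}_t/|\mathcal{Z}_t|$ for all $t\ge0$; equivalently $\vartheta_t=\mathrm{Im}\int_0^t d\mathcal{Z}_s/\mathcal{Z}_s$. *)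

theory Defs
  imports "HOL-Probability.Probability"
begin

section \<open>Continuous processes, Brownian motion and winding\<close>

text \<open>Processes are functions \<open>real \<Rightarrow> 'a \<Rightarrow> _\<close> of which only the values at times
  \<open>t \<ge> 0\<close> are relevant. Path properties are required almost surely.\<close>

definition continuous_process ::
    "'a measure \<Rightarrow> (real \<Rightarrow> 'a \<Rightarrow> 'b::topological_space) \<Rightarrow> bool" where
  "continuous_process M X \<longleftrightarrow>
     (\<forall>t\<ge>0. X t \<in> borel_measurable M) \<and>
     (AE \<omega> in M. continuous_on {0..} (\<lambda>t. X t \<omega>))"

definition brownian_motion :: "'a measure \<Rightarrow> real \<Rightarrow> (real \<Rightarrow> 'a \<Rightarrow> real) \<Rightarrow> bool" where
  "brownian_motion M x B \<longleftrightarrow>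
     prob_space M \<and>
     continuous_process M B \<and>
     (AE \<omega> in M. B 0 \<omega> = x) \<and>
     (\<forall>s t. 0 \<le> s \<and> s < t \<longrightarrow>
        distributed M lborel (\<lambda>\<omega>. B t \<omega> - B s \<omega>) (normal_density 0 (sqrt (t - s)))) \<and>
     (\<forall>(n::nat) \<tau>. 0 \<le> \<tau> 0 \<and> (\<forall>i<n. \<tau> i < \<tau> (Suc i)) \<longrightarrow>
        prob_space.indep_vars M (\<lambda>_. borel)
          (\<lambda>i \<omega>. B (\<tau> (Suc i)) \<omega> - B (\<tau> i) \<omega>) {..<n})"

abbreviation standard_brownian_motion :: "'a measure \<Rightarrow> (real \<Rightarrow> 'a \<Rightarrow> real) \<Rightarrow> bool" where
  "standard_brownian_motion M B \<equiv> brownian_motion M 0 B"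

text \<open>The two coordinate processes are independent as random elements of the product space
  indexed by all times \<open>t \<ge> 0\<close>.\<close>

definition planar_brownian_motion ::
    "'a measure \<Rightarrow> complex \<Rightarrow> (real \<Rightarrow> 'a \<Rightarrow> complex) \<Rightarrow> bool" where
  "planar_brownian_motion M z Z \<longleftrightarrow>
     brownian_motion M (Re z) (\<lambda>t \<omega>. Re (Z t \<omega>)) \<and>
     brownian_motion M (Im z) (\<lambda>t \<omega>. Im (Z t \<omega>)) \<and>
     prob_space.indep_var M
       (Pi\<^sub>M {0..} (\<lambda>_. borel)) (\<lambda>\<omega>. \<lambda>t\<in>{0..}. Re (Z t \<omega>))
       (Pi\<^sub>M {0..} (\<lambda>_. borel)) (\<lambda>\<omega>. \<lambda>t\<in>{0..}. Im (Z t \<omega>))"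

text \<open>Where \<open>Z t \<omega> = 0\<close>, the right-hand side of the last equation is \<open>0 / 0 = 0\<close>, which is not
  a value of \<open>exp\<close>; so the condition also says that almost surely \<open>Z\<close> never visits \<open>0\<close>.\<close>

definition winding_process ::
    "'a measure \<Rightarrow> (real \<Rightarrow> 'a \<Rightarrow> complex) \<Rightarrow> (real \<Rightarrow> 'a \<Rightarrow> real) \<Rightarrow> bool" where
  "winding_process M Z \<theta> \<longleftrightarrow>
     continuous_process M \<theta> \<and>
     (AE \<omega> in M. \<theta> 0 \<omega> = 0 \<and>
        (\<forall>t\<ge>0. exp (\<i> * complex_of_real (\<theta> t \<omega>)) = Z t \<omega> / complex_of_real (cmod (Z t \<omega>))))"


section \<open>Path space and convergence in distribution\<close>

text \<open>The space of continuous functions on \<open>{0..}\<close>, represented extensionally, with the topology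
  of uniform convergence on compact sets: the sets
  \<open>{g. \<forall>t\<in>{0..T}. \<bar>g t - f t\<bar> < e}\<close> form a neighbourhood base at \<open>f\<close>.\<close>

definition continuous_paths :: "(real \<Rightarrow> real) set" where
  "continuous_paths = {f. continuous_on {0..} f} \<inter> extensional {0..}"

definition path_topology :: "(real \<Rightarrow> real) topology" where
  "path_topology = topology (\<lambda>U. U \<subseteq> continuous_paths \<and>
     (\<forall>f\<in>U. \<exists>T>0. \<exists>e>0. \<forall>g\<in>continuous_paths. (\<forall>t\<in>{0..T}. \<bar>g t - f t\<bar> < e) \<longrightarrow> g \<in> U))"

lemma openin_path_topology:
  "openin path_topology U \<longleftrightarrow> U \<subseteq> continuous_paths \<and>
     (\<forall>f\<in>U. \<exists>T>0. \<exists>e>0. \<forall>g\<in>continuous_paths. (\<forall>t\<in>{0..T}. \<bar>g t - f t\<bar> < e) \<longrightarrow> g \<in> U)"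
proof -
  let ?P = "\<lambda>U. U \<subseteq> continuous_paths \<and>
     (\<forall>f\<in>U. \<exists>T>0::real. \<exists>e>0::real. \<forall>g\<in>continuous_paths.
        (\<forall>t\<in>{0..T}. \<bar>g t - f t\<bar> < e) \<longrightarrow> g \<in> U)"
  have "istopology ?P"
    unfolding istopology_def
  proof (intro conjI allI impI)
    fix S S' assume S: "?P S" and S': "?P S'"
    show "S \<inter> S' \<subseteq> continuous_paths" using S by blast
    show "\<forall>f\<in>S \<inter> S'. \<exists>T>0. \<exists>e>0. \<forall>g\<in>continuous_paths.
        (\<forall>t\<in>{0..T}. \<bar>g t - f t\<bar> < e) \<longrightarrow> g \<in> S \<inter> S'"
    proof
      fix f assume f: "f \<in> S \<inter> S'"
      obtain T e where 1: "T > 0" "e > 0"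
        "\<forall>g\<in>continuous_paths. (\<forall>t\<in>{0..T}. \<bar>g t - f t\<bar> < e) \<longrightarrow> g \<in> S"
        using S f by blast
      obtain T' e' where 2: "T' > 0" "e' > 0"
        "\<forall>g\<in>continuous_paths. (\<forall>t\<in>{0..T'}. \<bar>g t - f t\<bar> < e') \<longrightarrow> g \<in> S'"
        using S' f by blast
      have "\<forall>g\<in>continuous_paths.
          (\<forall>t\<in>{0..max T T'}. \<bar>g t - f t\<bar> < min e e') \<longrightarrow> g \<in> S \<inter> S'"
      proof (intro ballI impI IntI)
        fix g assume g: "g \<in> continuous_paths"
          and "\<forall>t\<in>{0..max T T'}. \<bar>g t - f t\<bar> < min e e'"
        then have "\<forall>t\<in>{0..T}. \<bar>g t - f t\<bar> < e" "\<forall>t\<in>{0..T'}. \<bar>g t - f t\<bar> < e'"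
          by auto
        then show "g \<in> S" "g \<in> S'" using 1(3) 2(3) g by blast+
      qed
      moreover have "max T T' > 0" "min e e' > 0" using 1 2 by auto
      ultimately show "\<exists>T>0. \<exists>e>0. \<forall>g\<in>continuous_paths.
          (\<forall>t\<in>{0..T}. \<bar>g t - f t\<bar> < e) \<longrightarrow> g \<in> S \<inter> S'"
        by blast
    qed
  next
    fix K assume K: "\<forall>S\<in>K. ?P S"
    show "\<Union>K \<subseteq> continuous_paths" using K by blast
    show "\<forall>f\<in>\<Union>K. \<exists>T>0. \<exists>e>0. \<forall>g\<in>continuous_paths.
        (\<forall>t\<in>{0..T}. \<bar>g t - f t\<bar> < e) \<longrightarrow> g \<in> \<Union>K"
    proof
      fix f assume "f \<in> \<Union>K"
      then obtain S where S: "S \<in> K" "f \<in> S" by blast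
      then obtain T e where "T > 0" "e > 0"
        "\<forall>g\<in>continuous_paths. (\<forall>t\<in>{0..T}. \<bar>g t - f t\<bar> < e) \<longrightarrow> g \<in> S"
        using K by blast
      with S show "\<exists>T>0. \<exists>e>0. \<forall>g\<in>continuous_paths.
          (\<forall>t\<in>{0..T}. \<bar>g t - f t\<bar> < e) \<longrightarrow> g \<in> \<Union>K"
        by blast
    qed
  qed
  then show ?thesis
    unfolding path_topology_def by (simp add: topology_inverse')
qed

lemma topspace_path_topology: "topspace path_topology = continuous_paths"
proof -
  have "openin path_topology continuous_paths"
    unfolding openin_path_topology using zero_less_one by blast
  moreover have "topspace path_topology \<subseteq> continuous_paths"
    using openin_topspace[of path_topology] unfolding openin_path_topology by (rule conjunct1)
  ultimately show ?thesis
    by (simp add: openin_subset subset_antisym)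
qed

definition borel_of :: "'a topology \<Rightarrow> 'a measure" where
  "borel_of T = sigma (topspace T) {U. openin T U}"

definition sample_path :: "(real \<Rightarrow> 'a \<Rightarrow> real) \<Rightarrow> 'a \<Rightarrow> real \<Rightarrow> real" where
  "sample_path X \<omega> =
     (if continuous_on {0..} (\<lambda>t. X t \<omega>) then (\<lambda>t\<in>{0..}. X t \<omega>) else (\<lambda>t\<in>{0..}. 0))"

text \<open>The null set on which the path of a continuous process is discontinuous need not be
  measurable, hence the completion.\<close>

definition path_law :: "'a measure \<Rightarrow> (real \<Rightarrow> 'a \<Rightarrow> real) \<Rightarrow> (real \<Rightarrow> real) measure" where
  "path_law M X = distr (completion M) (borel_of path_topology) (sample_path X)"

definition random_path :: "'a measure \<Rightarrow> (real \<Rightarrow> 'a \<Rightarrow> real) \<Rightarrow> bool" where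
  "random_path M X \<longleftrightarrow>
     continuous_process M X \<and>
     sample_path X \<in> measurable (completion M) (borel_of path_topology)"

definition weakly_converges ::
    "'a topology \<Rightarrow> ('i \<Rightarrow> 'a measure) \<Rightarrow> 'a measure \<Rightarrow> 'i filter \<Rightarrow> bool" where
  "weakly_converges T \<mu> \<nu> F \<longleftrightarrow>
     (\<forall>h. continuous_map T euclideanreal h \<and> bounded (h ` topspace T) \<longrightarrow>
        ((\<lambda>i. \<integral>x. h x \<partial>\<mu> i) \<longlongrightarrow> (\<integral>x. h x \<partial>\<nu>)) F)"

definition process_converges_in_distribution ::
    "'a measure \<Rightarrow> ('i \<Rightarrow> real \<Rightarrow> 'a \<Rightarrow> real) \<Rightarrow> 'b measure \<Rightarrow> (real \<Rightarrow> 'b \<Rightarrow> real)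
       \<Rightarrow> 'i filter \<Rightarrow> bool" where
  "process_converges_in_distribution M X N Y F \<longleftrightarrow>
     (\<forall>\<^sub>F i in F. random_path M (X i)) \<and>
     random_path N Y \<and>
     weakly_converges path_topology (\<lambda>i. path_law M (X i)) (path_law N Y) F"

end

theory Submission
  imports Defs
begin

text \<open>Over a short time the path stays near its starting point \<open>1\<close>, and there the angle is, to
  first order, the imaginary part: if \<open>Z = 1 + W\<close> with \<open>W\<close> small, then
  \<open>\<theta> = Im (Ln (1 + W)) = Im W + O(\<bar>W\<bar>\<^sup>2)\<close> (\<open>winding_angle_near_start\<close>).

  The process \<open>Im W\<close> is a standard Brownian motion. By Brownian scaling
  (\<open>brownian_motion_scaling\<close>) the process \<open>c powr (-1/2) * Im (W (c * t))\<close> is again one for each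
  \<open>c > 0\<close>, and all standard Brownian motions have the same law on path space
  (\<open>brownian_motion_path_law_unique\<close>). So this process has exactly the law of the limit for
  every \<open>c\<close>. On \<open>{0..c * T}\<close> both coordinates of \<open>W\<close> have size of order \<open>sqrt c\<close> with high
  probability, for the same reason, so the quadratic error is of order \<open>c\<close>. After multiplication
  by \<open>c powr (-1/2)\<close> it is of order \<open>sqrt c\<close> and vanishes in the limit, uniformly on \<open>{0..T}\<close>
  (\<open>rescaled_winding_near_imaginary_part\<close>).

  It remains to know that processes that are uniformly close in probability, on compact time
  intervals, to processes with a fixed law \<open>\<mu>\<close> converge in distribution to \<open>\<mu>\<close>
  (\<open>weakly_converges_if_close_in_probability\<close>).

  Uniqueness of the law of Brownian motion is a statement about its finite-dimensional
  distributions. It transfers to path space because the Borel sets of the topology of locally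
  uniform convergence are generated by the evaluations (\<open>sets_borel_of_path_topology\<close>).\<close>

section \<open>The Borel sets of path space\<close>

lemma space_borel_of: "space (borel_of T) = topspace T"
  unfolding borel_of_def by (rule space_measure_of) (auto dest: openin_subset)

lemma sets_borel_of: "sets (borel_of T) = sigma_sets (topspace T) {U. openin T U}"
  unfolding borel_of_def by (rule sets_measure_of) (auto dest: openin_subset)

lemma openin_in_sets_borel_of: "openin T U \<Longrightarrow> U \<in> sets (borel_of T)"
  by (auto simp: sets_borel_of)

lemma continuous_map_borel_measurable:
  fixes h :: "'a \<Rightarrow> real"
  assumes "continuous_map T euclideanreal h"
  shows "h \<in> borel_measurable (borel_of T)"
proof (rule borel_measurableI)
  fix S :: "real set" assume "open S"
  then have "openin T {x \<in> topspace T. h x \<in> S}"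
    using assms by (intro openin_continuous_map_preimage) auto
  moreover have "h -` S \<inter> space (borel_of T) = {x \<in> topspace T. h x \<in> S}"
    by (auto simp: space_borel_of)
  ultimately show "h -` S \<inter> space (borel_of T) \<in> sets (borel_of T)"
    by (simp add: openin_in_sets_borel_of)
qed

lemma continuous_map_path_evaluation:
  assumes "t \<ge> 0"
  shows "continuous_map path_topology euclideanreal (\<lambda>f. f t)"
proof -
  have "openin path_topology {f \<in> continuous_paths. f t \<in> S}" if "open S" for S
    unfolding openin_path_topology
  proof (intro conjI ballI)
    fix f assume "f \<in> {f \<in> continuous_paths. f t \<in> S}"
    then obtain e where e: "e > 0" "\<And>y. dist y (f t) < e \<Longrightarrow> y \<in> S"
      using \<open>open S\<close> by (auto simp: open_dist)
    show "\<exists>T>0. \<exists>e>0. \<forall>g\<in>continuous_paths. (\<forall>s\<in>{0..T}. \<bar>g s - f s\<bar> < e) \<longrightarrow>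
        g \<in> {f \<in> continuous_paths. f t \<in> S}"
      using assms e by (intro exI[of _ "t + 1"] conjI exI[of _ e]) (auto simp: dist_real_def)
  qed auto
  then show ?thesis
    by (auto simp: continuous_map_def topspace_path_topology)
qed

text \<open>A rational step path given by a mesh and a finite list of values, thickened by a tolerance.
  These sets are indexed by a countable type. The inequality is not strict, at the
  price that a tube need not be open, so that it can be tested at rational times alone. The mesh is
  \<open>1 / Suc n\<close> so that it is positive for every index.\<close>

definition path_tube :: "nat \<Rightarrow> nat \<Rightarrow> rat list \<Rightarrow> (real \<Rightarrow> real) set" where
  "path_tube n m q = {g \<in> continuous_paths.
     \<forall>i<length q. \<forall>t\<in>{real i / real (Suc n)..(real i + 1) / real (Suc n)}. \<bar>g t - of_rat (q ! i)\<bar> \<le> 1 / real m}"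

text \<open>The \<open>\<sigma>\<close>-algebra generated by the evaluations at fixed times.\<close>

abbreviation path_sigma_algebra :: "(real \<Rightarrow> real) measure" where
  "path_sigma_algebra \<equiv> restrict_space (Pi\<^sub>M {0..} (\<lambda>_. borel)) continuous_paths"

lemma space_path_sigma_algebra: "space path_sigma_algebra = continuous_paths"
  by (auto simp: space_restrict_space space_PiM PiE_def continuous_paths_def)

lemma measurable_path_evaluation [measurable (raw)]:
  assumes "t \<ge> 0"
  shows "(\<lambda>f. f t) \<in> borel_measurable path_sigma_algebra"
  using assms by (intro measurable_restrict_space1 measurable_component_singleton) auto

lemma abs_le_on_interval_if_rational:
  fixes g :: "real \<Rightarrow> real"
  assumes "a < b" "continuous_on {a..b} g"
    and "\<And>t. t \<in> {a..b} \<inter> \<rat> \<Longrightarrow> \<bar>g t - c\<bar> \<le> d" "t \<in> {a..b}"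
  shows "\<bar>g t - c\<bar> \<le> d"
proof -
  have "{a<..<b} \<subseteq> closure ({a<..<b} \<inter> \<rat>)"
    using open_Int_closure_subset[of "{a<..<b}" "\<rat>"] by (simp add: Rats_closure_real)
  then have "closure {a<..<b} \<subseteq> closure ({a<..<b} \<inter> \<rat>)"
    by (rule closure_minimal) simp
  moreover have "closure ({a<..<b} \<inter> \<rat>) \<subseteq> {a..b}"
    by (rule closure_minimal) auto
  ultimately have *: "closure ({a<..<b} \<inter> \<rat>) = {a..b}"
    using \<open>a < b\<close> by auto
  show ?thesis
    by (rule continuous_le_on_closure[where S = "{a<..<b} \<inter> \<rat>"])
       (use assms * in \<open>auto intro!: continuous_intros\<close>)
qed

text \<open>Along a continuous path the defining inequality of a tube holds on a whole interval as
  soon as it holds at the rational times of that interval, so a tube is cut out by countably many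
  conditions on evaluations.\<close>

lemma path_tube_measurable: "path_tube n m q \<in> sets path_sigma_algebra"
proof -
  let ?I = "\<lambda>i. {real i / real (Suc n)..(real i + 1) / real (Suc n)}"
  have nonneg: "t \<ge> 0" if "t \<in> ?I i" for i t
    using that by (auto intro: order_trans[rotated])
  have "path_tube n m q = {g \<in> space path_sigma_algebra.
      \<forall>i\<in>{..<length q}. \<forall>r\<in>{r. of_rat r \<in> ?I i}. \<bar>g (of_rat r) - of_rat (q ! i)\<bar> \<le> 1 / real m}"
  proof (intro set_eqI iffI)
    fix g assume g: "g \<in> {g \<in> space path_sigma_algebra.
      \<forall>i\<in>{..<length q}. \<forall>r\<in>{r. of_rat r \<in> ?I i}. \<bar>g (of_rat r) - of_rat (q ! i)\<bar> \<le> 1 / real m}"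
    then have "continuous_on {0..} g"
      unfolding space_path_sigma_algebra by (auto simp: continuous_paths_def)
    then have cont: "continuous_on (?I i) g" for i
      by (rule continuous_on_subset) (use nonneg in auto)
    have "\<bar>g t - of_rat (q ! i)\<bar> \<le> 1 / real m" if i: "i < length q" and t: "t \<in> ?I i" for i t
    proof (rule abs_le_on_interval_if_rational[OF _ cont])
      show "real i / real (Suc n) < (real i + 1) / real (Suc n)"
        by (rule divide_strict_right_mono) auto
      show "\<bar>g s - of_rat (q ! i)\<bar> \<le> 1 / real m" if s: "s \<in> ?I i \<inter> \<rat>" for s
      proof -
        from s obtain r where "s = of_rat r" by (auto elim: Rats_cases)
        then show ?thesis using g i s by blast
      qed
    qed (use t in auto)
    then show "g \<in> path_tube n m q"
      using g unfolding space_path_sigma_algebra path_tube_def by blast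
  next
    fix g assume "g \<in> path_tube n m q"
    then show "g \<in> {g \<in> space path_sigma_algebra. \<forall>i\<in>{..<length q}.
        \<forall>r\<in>{r. of_rat r \<in> ?I i}. \<bar>g (of_rat r) - of_rat (q ! i)\<bar> \<le> 1 / real m}"
      unfolding space_path_sigma_algebra path_tube_def by blast
  qed
  also have "\<dots> \<in> sets path_sigma_algebra"
  proof -
    have meas: "(\<lambda>g. g (of_rat r)) \<in> borel_measurable path_sigma_algebra"
      if "of_rat r \<in> ?I i" for i r
      by (rule measurable_path_evaluation[OF nonneg[OF that]])
    have "Measurable.pred path_sigma_algebra (\<lambda>g. \<forall>i\<in>{..<length q}. \<forall>r\<in>{r. of_rat r \<in> ?I i}.
        \<bar>g (of_rat r) - of_rat (q ! i)\<bar> \<le> 1 / real m)"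
    proof (intro pred_intros_countable_bounded(3))
      fix i r assume "r \<in> {r. of_rat r \<in> ?I i}"
      then have [measurable]: "(\<lambda>g. g (of_rat r)) \<in> borel_measurable path_sigma_algebra"
        by (intro meas) auto
      show "Measurable.pred path_sigma_algebra (\<lambda>g. \<bar>g (of_rat r) - of_rat (q ! i)\<bar> \<le> 1 / real m)"
        by measurable
    qed
    then show ?thesis by (rule predE)
  qed
  finally show ?thesis .
qed

text \<open>A path is uniformly continuous on compact time intervals, so a fine enough rational step path
  follows it closely; a tube around that step path contains the given path and only paths
  uniformly close to it. This makes every open set a countable union of tubes.\<close>

lemma path_tube_in_open_set:
  assumes U: "openin path_topology U" and f: "f \<in> U"
  shows "\<exists>n m q. f \<in> path_tube n m q \<and> path_tube n m q \<subseteq> U"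
proof -
  have fC: "f \<in> continuous_paths"
    using U f by (auto simp: openin_path_topology)
  obtain T e where T: "T > 0" "e > 0"
    "\<And>g. g \<in> continuous_paths \<Longrightarrow> (\<forall>t\<in>{0..T}. \<bar>g t - f t\<bar> < e) \<Longrightarrow> g \<in> U"
    using U f unfolding openin_path_topology by blast
  obtain m :: nat where m: "m > 0" "2 / real m < e"
    using reals_Archimedean2[of "2 / e"] T(2)
    by (metis divide_less_eq divide_pos_pos gr0I less_eq_real_def mult.commute not_less
        of_nat_0 of_nat_0_less_iff order_less_trans zero_less_numeral pos_divide_less_eq)
  define K where "K = nat \<lceil>T\<rceil> + 1"
  have K: "T < real K"
    unfolding K_def by linarith
  (* The mesh comes from uniform continuity on {0..K}; the centre values are rational
     approximations at the left ends of the cells. Each of the two errors costs half the tolerance. *)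
  have "continuous_on {0..real K} f"
    using fC by (auto simp: continuous_paths_def elim: continuous_on_subset)
  then have "uniformly_continuous_on {0..real K} f"
    by (intro compact_uniformly_continuous) auto
  then obtain d where d: "d > 0" "\<And>s t. s \<in> {0..real K} \<Longrightarrow> t \<in> {0..real K} \<Longrightarrow> \<bar>s - t\<bar> < d \<Longrightarrow>
      \<bar>f s - f t\<bar> < 1 / (2 * real m)"
    using m(1) unfolding uniformly_continuous_on_def dist_real_def
    by (metis divide_pos_pos mult_pos_pos of_nat_0_less_iff zero_less_numeral zero_less_one)
  obtain n0 :: nat where n0: "inverse (real (Suc n0)) < d"
    using reals_Archimedean[OF d(1)] by blast
  define n where "n = Suc n0"
  have n: "n > 0" "1 / real n < d"
    using n0 by (auto simp: n_def field_simps)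
  have "\<exists>r. \<bar>f (real i / real n) - of_rat r\<bar> < 1 / (2 * real m)" for i
  proof -
    obtain r where "r \<in> \<rat>" "\<bar>r - f (real i / real n)\<bar> < 1 / (2 * real m)"
      using rational_approximation[of "1 / (2 * real m)" "f (real i / real n)"] m(1) by auto
    then show ?thesis
      by (auto elim!: Rats_cases simp: abs_minus_commute)
  qed
  then obtain r where r: "\<And>i. \<bar>f (real i / real n) - of_rat (r i)\<bar> < 1 / (2 * real m)"
    by metis
  have tube_eq: "path_tube n0 m q = {g \<in> continuous_paths. \<forall>i<length q.
      \<forall>t\<in>{real i / real n..(real i + 1) / real n}. \<bar>g t - of_rat (q ! i)\<bar> \<le> 1 / real m}" for q
    by (simp only: path_tube_def n_def)
  define q where "q = map r [0..<K * n]"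
  have len: "length q = K * n" and nth: "\<And>i. i < K * n \<Longrightarrow> q ! i = r i"
    by (auto simp: q_def)
  have tube: "\<bar>f t - of_rat (q ! i)\<bar> \<le> 1 / real m"
    if i: "i < length q" and t: "t \<in> {real i / real n..(real i + 1) / real n}" for i t
  proof -
    have "(real i + 1) / real n \<le> real K"
    proof -
      have "real (Suc i) \<le> real (K * n)"
        using i len by (simp only: of_nat_le_iff Suc_leI)
      then show ?thesis using n by (simp add: field_simps)
    qed
    moreover have "0 \<le> real i / real n" by simp
    moreover have "(real i + 1) / real n = real i / real n + 1 / real n"
      by (simp add: add_divide_distrib)
    moreover from calculation t have "0 \<le> t" by (meson atLeastAtMost_iff order_trans)
    ultimately have "\<bar>f t - f (real i / real n)\<bar> < 1 / (2 * real m)"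
      using t n by (intro d(2)) auto
    with r[of i] nth[of i] i len have "\<bar>f t - of_rat (q ! i)\<bar> < 1 / (2 * real m) + 1 / (2 * real m)"
      by simp
    then show ?thesis by simp
  qed
  have "path_tube n0 m q \<subseteq> U"
  proof
    fix g assume g: "g \<in> path_tube n0 m q"
    show "g \<in> U"
    proof (rule T(3))
      show "g \<in> continuous_paths" using g by (simp add: tube_eq)
      show "\<forall>t\<in>{0..T}. \<bar>g t - f t\<bar> < e"
      proof
        fix t assume t: "t \<in> {0..T}"
        define i where "i = nat \<lfloor>t * real n\<rfloor>"
        have i: "real i \<le> t * real n" "t * real n < real i + 1"
          using t unfolding i_def by (auto simp: of_nat_nat)
        have "t * real n < real K * real n"
          using t K n by (intro mult_strict_right_mono) auto
        with i(1) have "real i < real (K * n)" by simp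
        then have "i < length q" unfolding len of_nat_less_iff .
        moreover have "t \<in> {real i / real n..(real i + 1) / real n}"
          using i n by (auto simp: field_simps)
        ultimately have "\<bar>g t - of_rat (q ! i)\<bar> \<le> 1 / real m" "\<bar>f t - of_rat (q ! i)\<bar> \<le> 1 / real m"
          using g tube by (auto simp: tube_eq)
        moreover have "1 / real m + 1 / real m = 2 / real m" by simp
        ultimately show "\<bar>g t - f t\<bar> < e" using m(2) by linarith
      qed
    qed
  qed
  moreover have "f \<in> path_tube n0 m q"
    using fC tube by (auto simp: tube_eq)
  ultimately show ?thesis by blast
qed

text \<open>An open set is the union of the tubes that it contains. There are only countably many tubes,
  and each is measurable with respect to the evaluations. Conversely, evaluations are continuous.\<close>

lemma sets_borel_of_path_topology:
  "sets (borel_of path_topology) = sets path_sigma_algebra"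
proof
  have "U \<in> sets path_sigma_algebra" if U: "openin path_topology U" for U
  proof -
    let ?tube = "\<lambda>(n, m, q). path_tube n m q"
    have "U = (\<Union>p\<in>{p. ?tube p \<subseteq> U}. ?tube p)"
      using path_tube_in_open_set[OF U] by (fastforce)
    also have "\<dots> \<in> sets path_sigma_algebra"
      by (intro sets.countable_UN') (auto intro: path_tube_measurable)
    finally show ?thesis .
  qed
  then show "sets (borel_of path_topology) \<subseteq> sets path_sigma_algebra"
    unfolding sets_borel_of topspace_path_topology
    by (metis (mono_tags, lifting) mem_Collect_eq sets.sigma_sets_subset space_path_sigma_algebra subsetI)
  have "(\<lambda>f. f) \<in> measurable (borel_of path_topology) (Pi\<^sub>M {0..} (\<lambda>_. borel :: real measure))"
    by (rule measurable_PiM_single')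
       (auto intro!: continuous_map_borel_measurable continuous_map_path_evaluation
         simp: space_borel_of topspace_path_topology continuous_paths_def PiE_def)
  then have "(\<lambda>f. f) \<in> measurable (borel_of path_topology) path_sigma_algebra"
    by (rule measurable_restrict_space2[rotated])
       (auto simp: space_borel_of topspace_path_topology)
  then have "A \<in> sets (borel_of path_topology)" if "A \<in> sets path_sigma_algebra" for A
    using measurable_sets[OF _ that, of "\<lambda>f. f" "borel_of path_topology"]
      sets.sets_into_space[OF that]
    by (simp add: space_borel_of topspace_path_topology space_path_sigma_algebra Int_absorb2)
  then show "sets path_sigma_algebra \<subseteq> sets (borel_of path_topology)" by auto
qed

section \<open>Laws of continuous processes\<close>

lemma measurable_path_space:
  assumes "\<And>\<omega>. \<omega> \<in> space P \<Longrightarrow> X \<omega> \<in> continuous_paths"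
    and "\<And>t. t \<ge> 0 \<Longrightarrow> (\<lambda>\<omega>. X \<omega> t) \<in> borel_measurable P"
  shows "X \<in> measurable P (borel_of path_topology)"
proof -
  have "X \<in> measurable P path_sigma_algebra"
    using assms
    by (intro measurable_restrict_space2 measurable_PiM_single')
       (auto simp: continuous_paths_def PiE_def)
  then show ?thesis
    by (simp add: measurable_cong_sets[OF refl sets_borel_of_path_topology])
qed

lemma sample_path_in_continuous_paths: "sample_path X \<omega> \<in> continuous_paths"
proof -
  have "(\<lambda>t\<in>{0..}. f t) \<in> continuous_paths" if "continuous_on {0..} f" for f :: "real \<Rightarrow> real"
    using that continuous_on_cong[of "{0..}" "{0..}" f "\<lambda>t\<in>{0..}. f t"]
    by (simp add: continuous_paths_def)
  then show ?thesis by (simp add: sample_path_def)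
qed

lemma AE_sample_path:
  assumes "continuous_process M X"
  shows "AE \<omega> in M. sample_path X \<omega> = (\<lambda>t\<in>{0..}. X t \<omega>)"
  using assms by (auto simp: continuous_process_def sample_path_def)

lemma borel_measurable_completion_AE:
  fixes f g :: "'a \<Rightarrow> real"
  assumes "f \<in> borel_measurable M" "AE \<omega> in M. f \<omega> = g \<omega>"
  shows "g \<in> borel_measurable (completion M)"
proof (rule measurableI)
  fix A :: "real set" assume A: "A \<in> sets borel"
  have "f -` A \<inter> space M \<in> sets (completion M)"
    using measurable_sets[OF assms(1) A] by simp
  then show "g -` A \<inter> space (completion M) \<in> sets (completion M)"
    by (rule complete_measure.in_sets_AE[OF completion.complete_measure_axioms, rotated])
       (use AE_completion[OF assms(2)] in auto)
qed auto

lemma sample_path_measurable: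
  assumes "continuous_process M X"
  shows "sample_path X \<in> measurable (completion M) (borel_of path_topology)"
proof (rule measurable_path_space)
  fix t :: real assume "t \<ge> 0"
  then have "X t \<in> borel_measurable M" "AE \<omega> in M. X t \<omega> = sample_path X \<omega> t"
    using assms AE_sample_path[OF assms] by (auto simp: continuous_process_def)
  then show "(\<lambda>\<omega>. sample_path X \<omega> t) \<in> borel_measurable (completion M)"
    by (rule borel_measurable_completion_AE)
qed (rule sample_path_in_continuous_paths)

lemma random_path_if_continuous_process: "continuous_process M X \<Longrightarrow> random_path M X"
  by (simp add: random_path_def sample_path_measurable)

text \<open>The law on path space is the trace of the law on the product space of all real functions of
  time. The set of continuous paths is not measurable in that product space, so this cannot be
  stated by restricting the measure.\<close>

lemma emeasure_path_law:
  assumes X: "continuous_process M X" and A: "A \<in> sets (Pi\<^sub>M {0..} (\<lambda>_. borel))"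
  shows "emeasure (path_law M X) (continuous_paths \<inter> A) =
    emeasure (distr M (Pi\<^sub>M {0..} (\<lambda>_. borel)) (\<lambda>\<omega>. \<lambda>t\<in>{0..}. X t \<omega>)) A"
proof -
  have meas: "(\<lambda>\<omega>. \<lambda>t\<in>{0..}. X t \<omega>) \<in> measurable M (Pi\<^sub>M {0..} (\<lambda>_. borel))"
    using X by (intro measurable_restrict) (auto simp: continuous_process_def)
  have "continuous_paths \<inter> A \<in> sets (borel_of path_topology)"
    using A unfolding sets_borel_of_path_topology by (auto simp: sets_restrict_space)
  note meas_path = measurable_sets[OF sample_path_measurable[OF X] this]
    and emeasure_distr[OF sample_path_measurable[OF X] this]
  then have "emeasure (path_law M X) (continuous_paths \<inter> A) =
      emeasure (completion M) (sample_path X -` (continuous_paths \<inter> A) \<inter> space M)"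
    by (simp add: path_law_def)
  also have "emeasure (completion M) (sample_path X -` (continuous_paths \<inter> A) \<inter> space M) =
      emeasure (completion M) ((\<lambda>\<omega>. \<lambda>t\<in>{0..}. X t \<omega>) -` A \<inter> space M)"
  proof (rule emeasure_eq_AE)
    show "AE \<omega> in completion M. \<omega> \<in> sample_path X -` (continuous_paths \<inter> A) \<inter> space M \<longleftrightarrow>
        \<omega> \<in> (\<lambda>\<omega>. \<lambda>t\<in>{0..}. X t \<omega>) -` A \<inter> space M"
      using AE_completion[OF AE_sample_path[OF X]]
    proof eventually_elim
      case (elim \<omega>)
      then show ?case using sample_path_in_continuous_paths[of X \<omega>] by auto
    qed
  qed (use meas_path measurable_sets[OF meas A] in simp_all)
  also have "\<dots> = emeasure (distr M (Pi\<^sub>M {0..} (\<lambda>_. borel)) (\<lambda>\<omega>. \<lambda>t\<in>{0..}. X t \<omega>)) A"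
    using measurable_sets[OF meas A] by (simp add: emeasure_distr[OF meas A])
  finally show ?thesis .
qed

text \<open>By the uniqueness of measures on infinite products, a law on path space is determined by its
  finite-dimensional distributions.\<close>

lemma path_law_eqI:
  assumes X: "continuous_process M X" and Y: "continuous_process N Y" and "finite_measure M"
    and fdd: "\<And>J. finite J \<Longrightarrow> J \<subseteq> {0..} \<Longrightarrow>
      distr M (Pi\<^sub>M J (\<lambda>_. borel)) (\<lambda>\<omega>. \<lambda>t\<in>J. X t \<omega>) =
      distr N (Pi\<^sub>M J (\<lambda>_. borel)) (\<lambda>\<omega>. \<lambda>t\<in>J. Y t \<omega>)"
  shows "path_law M X = path_law N Y"
proof (rule measure_eqI)
  let ?PiM = "\<lambda>I. Pi\<^sub>M I (\<lambda>_. borel :: real measure)"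
  let ?X = "\<lambda>J \<omega>. \<lambda>t\<in>J. X t \<omega>" and ?Y = "\<lambda>J \<omega>. \<lambda>t\<in>J. Y t \<omega>"
  have meas: "?X J \<in> measurable M (?PiM J)" "?Y J \<in> measurable N (?PiM J)" if "J \<subseteq> {0..}" for J
    using X Y that by (auto intro!: measurable_restrict simp: continuous_process_def)
  have "distr M (?PiM {0..}) (?X {0..}) = distr N (?PiM {0..}) (?Y {0..})"
  proof (rule measure_eqI_PiM_infinite)
    fix A :: "real \<Rightarrow> real set" and J :: "real set"
    assume J: "finite J" "J \<subseteq> {0..}" and A: "\<And>i. i \<in> J \<Longrightarrow> A i \<in> sets borel"
    have emb: "prod_emb {0..} (\<lambda>_. borel) J (Pi\<^sub>E J A) \<in> sets (?PiM {0..})"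
      using J A by (intro sets_PiM_I) auto
    have box: "Pi\<^sub>E J A \<in> sets (?PiM J)"
      using J A by (intro sets_PiM_I_finite) auto
    have pre: "(\<lambda>\<omega>. \<lambda>t\<in>{0..}. V t \<omega>) -` prod_emb {0..} (\<lambda>_. borel) J (Pi\<^sub>E J A) =
        (\<lambda>\<omega>. \<lambda>t\<in>J. V t \<omega>) -` Pi\<^sub>E J A" for V :: "real \<Rightarrow> 'c \<Rightarrow> real"
      using J by (auto simp: prod_emb_def PiE_def Pi_def)
    show "emeasure (distr M (?PiM {0..}) (?X {0..})) (prod_emb {0..} (\<lambda>_. borel) J (Pi\<^sub>E J A)) =
        emeasure (distr N (?PiM {0..}) (?Y {0..})) (prod_emb {0..} (\<lambda>_. borel) J (Pi\<^sub>E J A))"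
      using arg_cong[OF fdd[OF J], of "\<lambda>\<mu>. emeasure \<mu> (Pi\<^sub>E J A)"] emb box J meas
      by (simp add: emeasure_distr pre)
  qed (use \<open>finite_measure M\<close> meas in \<open>auto intro!: finite_measure.finite_measure_distr\<close>)
  note eq = this
  fix A assume "A \<in> sets (path_law M X)"
  then obtain A' where "A' \<in> sets (?PiM {0..})" "A = continuous_paths \<inter> A'"
    by (auto simp: path_law_def sets_borel_of_path_topology sets_restrict_space)
  then show "emeasure (path_law M X) A = emeasure (path_law N Y) A"
    using emeasure_path_law[OF X] emeasure_path_law[OF Y] eq by simp
qed (simp add: path_law_def)

section \<open>Brownian motion has a unique law\<close>

lemma brownian_motion_increments_law:
  assumes B: "brownian_motion M x B"
    and \<tau>: "0 \<le> \<tau> 0" "\<And>i. i < n \<Longrightarrow> \<tau> i < \<tau> (Suc i)" and "n > 0"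
  shows "distr M (Pi\<^sub>M {..<n} (\<lambda>_. borel)) (\<lambda>\<omega>. \<lambda>i\<in>{..<n}. B (\<tau> (Suc i)) \<omega> - B (\<tau> i) \<omega>) =
    Pi\<^sub>M {..<n} (\<lambda>i. density lborel (normal_density 0 (sqrt (\<tau> (Suc i) - \<tau> i))))"
proof -
  interpret prob_space M using B by (simp add: brownian_motion_def)
  have nonneg: "0 \<le> \<tau> i" if "i \<le> n" for i
    using that
  proof (induction i)
    case (Suc i)
    then show ?case using \<tau>(2)[of i] by simp
  qed (use \<tau> in simp)
  have meas: "B t \<in> borel_measurable M" if "t \<ge> 0" for t
    using B that by (simp add: brownian_motion_def continuous_process_def)
  have "indep_vars (\<lambda>_. borel) (\<lambda>i \<omega>. B (\<tau> (Suc i)) \<omega> - B (\<tau> i) \<omega>) {..<n}"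
    using B \<tau> by (simp add: brownian_motion_def)
  then have "distr M (Pi\<^sub>M {..<n} (\<lambda>_. borel)) (\<lambda>\<omega>. \<lambda>i\<in>{..<n}. B (\<tau> (Suc i)) \<omega> - B (\<tau> i) \<omega>) =
      Pi\<^sub>M {..<n} (\<lambda>i. distr M borel (\<lambda>\<omega>. B (\<tau> (Suc i)) \<omega> - B (\<tau> i) \<omega>))"
    using \<open>n > 0\<close> nonneg
    by (subst (asm) indep_vars_iff_distr_eq_PiM') (auto intro!: borel_measurable_diff meas)
  also have "\<dots> = Pi\<^sub>M {..<n} (\<lambda>i. density lborel (normal_density 0 (sqrt (\<tau> (Suc i) - \<tau> i))))"
  proof (rule PiM_cong)
    fix i assume "i \<in> {..<n}"
    then have "distributed M lborel (\<lambda>\<omega>. B (\<tau> (Suc i)) \<omega> - B (\<tau> i) \<omega>)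
        (normal_density 0 (sqrt (\<tau> (Suc i) - \<tau> i)))"
      using B \<tau>(2) nonneg by (simp add: brownian_motion_def)
    then show "distr M borel (\<lambda>\<omega>. B (\<tau> (Suc i)) \<omega> - B (\<tau> i) \<omega>) =
        density lborel (normal_density 0 (sqrt (\<tau> (Suc i) - \<tau> i)))"
      by (metis (no_types, lifting) distr_cong distributed_distr_eq_density sets_lborel)
  qed simp
  finally show ?thesis .
qed

text \<open>Brownian motion is described by its increments along a chain of times. A finite set of times
  is put on such a chain; adding the time \<open>0\<close> makes the starting value available, and adding the
  time \<open>1\<close> guarantees at least one increment.\<close>

lemma finite_times_enumeration:
  fixes J :: "real set"
  assumes "finite J" "J \<subseteq> {0..}"
  obtains \<tau> :: "nat \<Rightarrow> real" and n where
    "n > 0" "\<tau> 0 = 0" "\<And>i. i < n \<Longrightarrow> \<tau> i < \<tau> (Suc i)" "J \<subseteq> \<tau> ` {..n}"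
proof -
  define L where "L = sorted_list_of_set (insert 0 (insert 1 J))"
  have set: "set L = insert 0 (insert 1 J)" and sorted: "sorted_wrt (<) L"
    using assms by (auto simp: L_def simp del: sorted_list_of_set_insert_remove)
  have "card (set L) \<ge> card {0, 1 :: real}"
    using assms(1) by (intro card_mono) (auto simp: set)
  then have len: "length L \<ge> 2"
    using card_length[of L] by simp
  have less: "L ! i < L ! Suc i" if "i < length L - 1" for i
    using sorted_wrt_nth_less[OF sorted, of i "Suc i"] that by simp
  have "L ! 0 = 0"
  proof -
    obtain k where k: "k < length L" "L ! k = 0"
      using set by (metis in_set_conv_nth insertI1)
    have "L ! 0 \<in> set L"
      using len by (intro nth_mem) linarith
    then have "L ! 0 \<ge> 0"
      using set assms by auto
    moreover have "L ! 0 < L ! k" if "k > 0"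
      using sorted_wrt_nth_less[OF sorted that k(1)] .
    ultimately show ?thesis using k by (cases "k = 0") auto
  qed
  moreover have "J \<subseteq> (!) L ` {..length L - 1}"
  proof
    fix t assume "t \<in> J"
    then have "t \<in> set L" by (simp add: set)
    then obtain k where "k < length L" "L ! k = t" by (auto simp: in_set_conv_nth)
    then show "t \<in> (!) L ` {..length L - 1}" by force
  qed
  ultimately show thesis
    using less len by (intro that[of "length L - 1" "(!) L"]) auto
qed

text \<open>The values at finitely many times are partial sums of increments, hence the image under one
  fixed map \<open>F\<close> of a vector of independent normal variables with prescribed variances.\<close>

lemma brownian_motion_finite_dimensional_law:
  assumes B: "brownian_motion M x B" and W: "brownian_motion N x W"
    and J: "finite J" "J \<subseteq> {0..}"
  shows "distr M (Pi\<^sub>M J (\<lambda>_. borel)) (\<lambda>\<omega>. \<lambda>t\<in>J. B t \<omega>) =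
    distr N (Pi\<^sub>M J (\<lambda>_. borel)) (\<lambda>\<omega>. \<lambda>t\<in>J. W t \<omega>)"
proof -
  obtain \<tau> :: "nat \<Rightarrow> real" and n where \<tau>: "n > 0" "\<tau> 0 = 0" "\<And>i. i < n \<Longrightarrow> \<tau> i < \<tau> (Suc i)"
    and "J \<subseteq> \<tau> ` {..n}"
    using finite_times_enumeration[OF J] by metis
  then have "\<forall>t\<in>J. \<exists>k\<le>n. t = \<tau> k" by auto
  then obtain k where k: "\<And>t. t \<in> J \<Longrightarrow> k t \<le> n" "\<And>t. t \<in> J \<Longrightarrow> \<tau> (k t) = t"
    by metis
  define F where "F = (\<lambda>y. \<lambda>t\<in>J. x + (\<Sum>i<k t. y i :: real))"
  have F: "F \<in> measurable (Pi\<^sub>M {..<n} (\<lambda>_. borel)) (Pi\<^sub>M J (\<lambda>_. borel))"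
    unfolding F_def
  proof (intro measurable_restrict borel_measurable_add borel_measurable_sum borel_measurable_const)
    fix t i assume "t \<in> J" "i \<in> {..<k t}"
    then show "(\<lambda>y. y i) \<in> borel_measurable (Pi\<^sub>M {..<n} (\<lambda>_. borel))"
      using k(1)[of t] by (intro measurable_component_singleton) auto
  qed
  have nonneg: "0 \<le> \<tau> i" if "i \<le> n" for i
    using that
  proof (induction i)
    case (Suc i)
    then show ?case using \<tau>(3)[of i] by simp
  qed (use \<tau> in simp)
  have law: "distr P (Pi\<^sub>M J (\<lambda>_. borel)) (\<lambda>\<omega>. \<lambda>t\<in>J. X t \<omega>) =
      distr (Pi\<^sub>M {..<n} (\<lambda>i. density lborel (normal_density 0 (sqrt (\<tau> (Suc i) - \<tau> i)))))
        (Pi\<^sub>M J (\<lambda>_. borel)) F"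
    if X: "brownian_motion P x X" for P :: "'c measure" and X
  proof -
    let ?D = "\<lambda>\<omega>. \<lambda>i\<in>{..<n}. X (\<tau> (Suc i)) \<omega> - X (\<tau> i) \<omega>"
    have meas: "X t \<in> borel_measurable P" if "t \<ge> 0" for t
      using X that by (simp add: brownian_motion_def continuous_process_def)
    have D: "?D \<in> measurable P (Pi\<^sub>M {..<n} (\<lambda>_. borel))"
      using nonneg by (intro measurable_restrict borel_measurable_diff meas) auto
    have "AE \<omega> in P. X 0 \<omega> = x"
      using X by (simp add: brownian_motion_def)
    then have "AE \<omega> in P. (\<lambda>t\<in>J. X t \<omega>) = F (?D \<omega>)"
    proof eventually_elim
      case (elim \<omega>)
      have "F (?D \<omega>) t = X t \<omega>" if t: "t \<in> J" for t
      proof -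
        have "(\<Sum>i<k t. ?D \<omega> i) = (\<Sum>i<k t. X (\<tau> (Suc i)) \<omega> - X (\<tau> i) \<omega>)"
          using k(1)[OF t] by (intro sum.cong) auto
        also have "\<dots> = X t \<omega> - x"
          using k(2)[OF t] elim \<tau>(2) by (simp add: sum_lessThan_telescope[of "\<lambda>i. X (\<tau> i) \<omega>"])
        finally show ?thesis using t by (simp add: F_def)
      qed
      then show ?case by (auto simp: F_def restrict_def fun_eq_iff)
    qed
    then have "distr P (Pi\<^sub>M J (\<lambda>_. borel)) (\<lambda>\<omega>. \<lambda>t\<in>J. X t \<omega>) =
        distr P (Pi\<^sub>M J (\<lambda>_. borel)) (\<lambda>\<omega>. F (?D \<omega>))"
      using J by (intro distr_cong_AE refl measurable_restrict meas measurable_compose[OF D F]) auto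
    also have "\<dots> = distr (distr P (Pi\<^sub>M {..<n} (\<lambda>_. borel)) ?D) (Pi\<^sub>M J (\<lambda>_. borel)) F"
      using distr_distr[OF F D] by (simp add: comp_def)
    also have "distr P (Pi\<^sub>M {..<n} (\<lambda>_. borel)) ?D =
        Pi\<^sub>M {..<n} (\<lambda>i. density lborel (normal_density 0 (sqrt (\<tau> (Suc i) - \<tau> i))))"
      using \<tau> by (intro brownian_motion_increments_law[OF X]) auto
    finally show ?thesis .
  qed
  show ?thesis by (simp only: law[OF B] law[OF W])
qed

lemma brownian_motion_path_law_unique:
  assumes "brownian_motion M x B" "brownian_motion N x W"
  shows "path_law M B = path_law N W"
proof (rule path_law_eqI)
  interpret prob_space M using assms by (simp add: brownian_motion_def)
  show "finite_measure M" by (rule finite_measure_axioms)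
qed (use assms brownian_motion_finite_dimensional_law[OF assms] in \<open>auto simp: brownian_motion_def\<close>)

lemma continuous_process_rescaled:
  fixes X :: "real \<Rightarrow> 'a \<Rightarrow> real"
  assumes X: "continuous_process M X" and "c > 0"
  shows "continuous_process M (\<lambda>t \<omega>. a * (X (c * t) \<omega> - x))"
  unfolding continuous_process_def
proof (intro conjI allI impI)
  fix t :: real assume "t \<ge> 0"
  then have "X (c * t) \<in> borel_measurable M"
    using X \<open>c > 0\<close> by (simp add: continuous_process_def)
  then show "(\<lambda>\<omega>. a * (X (c * t) \<omega> - x)) \<in> borel_measurable M" by simp
next
  have "AE \<omega> in M. continuous_on {0..} (\<lambda>t. X t \<omega>)"
    using X by (simp add: continuous_process_def)
  then show "AE \<omega> in M. continuous_on {0..} (\<lambda>t. a * (X (c * t) \<omega> - x))"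
  proof eventually_elim
    case (elim \<omega>)
    have "continuous_on {0..} (\<lambda>t. X (c * t) \<omega>)"
      using \<open>c > 0\<close> by (intro continuous_on_compose2[OF elim] continuous_intros) auto
    then show ?case by (intro continuous_intros)
  qed
qed

lemma brownian_motion_scaling:
  assumes B: "brownian_motion M x B" and "c > 0"
  shows "standard_brownian_motion M (\<lambda>t \<omega>. c powr (-1/2) * (B (c * t) \<omega> - x))"
proof -
  interpret prob_space M using B by (simp add: brownian_motion_def)
  let ?a = "c powr (-1/2)"
  have a: "?a > 0" "?a * sqrt c = 1"
    using \<open>c > 0\<close> by (auto simp: powr_half_sqrt[symmetric] powr_add[symmetric])
  have diff: "?a * (B (c * t) \<omega> - x) - ?a * (B (c * s) \<omega> - x) = ?a * (B (c * t) \<omega> - B (c * s) \<omega>)"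
    for s t \<omega> by (simp add: algebra_simps)
  have cont: "continuous_process M (\<lambda>t \<omega>. ?a * (B (c * t) \<omega> - x))"
    using B \<open>c > 0\<close> by (intro continuous_process_rescaled) (auto simp: brownian_motion_def)
  show ?thesis
    unfolding brownian_motion_def diff
  proof (intro conjI allI impI)
    show "AE \<omega> in M. ?a * (B (c * 0) \<omega> - x) = 0"
      using B by (auto simp: brownian_motion_def)
  next
    fix s t :: real assume st: "0 \<le> s \<and> s < t"
    then have "distributed M lborel (\<lambda>\<omega>. B (c * t) \<omega> - B (c * s) \<omega>)
        (normal_density 0 (sqrt (c * t - c * s)))"
      using B \<open>c > 0\<close> by (simp add: brownian_motion_def)
    from normal_density_affine[OF this, of ?a 0]
    have "distributed M lborel (\<lambda>\<omega>. ?a * (B (c * t) \<omega> - B (c * s) \<omega>))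
        (normal_density 0 (?a * sqrt (c * t - c * s)))"
      using st a \<open>c > 0\<close> by simp
    also have "?a * sqrt (c * t - c * s) = sqrt (t - s)"
      using a(2) by (simp add: right_diff_distrib[symmetric] real_sqrt_mult mult.assoc[symmetric])
    finally show "distributed M lborel (\<lambda>\<omega>. ?a * (B (c * t) \<omega> - B (c * s) \<omega>))
        (normal_density 0 (sqrt (t - s)))" .
  next
    fix n :: nat and \<tau> :: "nat \<Rightarrow> real" assume \<tau>: "0 \<le> \<tau> 0 \<and> (\<forall>i<n. \<tau> i < \<tau> (Suc i))"
    have "\<forall>n \<tau>. 0 \<le> \<tau> 0 \<and> (\<forall>i<n. \<tau> i < \<tau> (Suc i)) \<longrightarrow>
        indep_vars (\<lambda>_. borel) (\<lambda>i \<omega>. B (\<tau> (Suc i)) \<omega> - B (\<tau> i) \<omega>) {..<n}"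
      using B by (simp add: brownian_motion_def)
    from this[rule_format, of "\<lambda>i. c * \<tau> i" n]
    have "indep_vars (\<lambda>_. borel) (\<lambda>i \<omega>. B (c * \<tau> (Suc i)) \<omega> - B (c * \<tau> i) \<omega>) {..<n}"
      using \<tau> \<open>c > 0\<close> by simp
    then show "indep_vars (\<lambda>_. borel) (\<lambda>i \<omega>. ?a * (B (c * \<tau> (Suc i)) \<omega> - B (c * \<tau> i) \<omega>)) {..<n}"
      by (rule indep_vars_compose2) simp
  qed (use cont prob_space_axioms in auto)
qed

section \<open>The angle of a planar path near its starting point\<close>

text \<open>While \<open>z\<close> stays in the disc of radius \<open>1 / 2\<close> around \<open>1\<close>, the cosine of the angle is positive;
  an angle that starts at \<open>0\<close> and varies continuously therefore cannot leave \<open>(- pi / 2, pi / 2)\<close>.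
  So it is the principal angle \<open>Im (Ln z)\<close>, and \<open>Ln (1 + w) = w + O(w\<^sup>2)\<close>.\<close>

lemma winding_angle_near_start:
  fixes \<phi> :: "real \<Rightarrow> real"
  assumes cont: "continuous_on {0..s} \<phi>" and "\<phi> 0 = 0"
    and arg: "\<And>t. t \<in> {0..s} \<Longrightarrow> exp (\<i> * complex_of_real (\<phi> t)) = z t / complex_of_real (cmod (z t))"
    and near: "\<And>t. t \<in> {0..s} \<Longrightarrow> cmod (z t - 1) \<le> 1 / 2"
    and t: "t \<in> {0..s}"
  shows "\<bar>\<phi> t - Im (z t)\<bar> \<le> 2 * (cmod (z t - 1))\<^sup>2"
proof -
  have Re: "Re (z u) > 0" if "u \<in> {0..s}" for u
    using near[OF that] abs_Re_le_cmod[of "z u - 1"] by simp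
  have cos: "cos (\<phi> u) > 0" if "u \<in> {0..s}" for u
  proof -
    have "cos (\<phi> u) = Re (z u / complex_of_real (cmod (z u)))"
      using arg[OF that] by (metis cis.simps(1) cis_conv_exp)
    also have "\<dots> = Re (z u) / cmod (z u)" by simp
    also have "\<dots> > 0" using Re[OF that] by (intro divide_pos_pos) auto
    finally show ?thesis .
  qed
  have small: "\<bar>\<phi> t\<bar> < pi / 2"
  proof (rule ccontr)
    assume "\<not> \<bar>\<phi> t\<bar> < pi / 2"
    then have "\<exists>u. 0 \<le> u \<and> u \<le> t \<and> \<bar>\<phi> u\<bar> = pi / 2"
      using t \<open>\<phi> 0 = 0\<close> continuous_on_subset[OF continuous_on_rabs[OF cont], of "{0..t}"]
      by (intro IVT'[of "\<lambda>u. \<bar>\<phi> u\<bar>"]) auto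
    then obtain u where "u \<in> {0..s}" "\<bar>\<phi> u\<bar> = pi / 2"
      using t by (meson atLeastAtMost_iff order_trans)
    then show False using cos[of u] by (metis cos_abs_real cos_pi_half less_irrefl)
  qed
  have "cmod (z t) > 0" using Re[OF t] by auto
  then have "z t = exp (complex_of_real (ln (cmod (z t))) + \<i> * complex_of_real (\<phi> t))"
    using arg[OF t] by (simp add: exp_add exp_of_real)
  moreover have "- pi < \<phi> t" "\<phi> t \<le> pi"
    using small by linarith+
  ultimately have "Ln (z t) = complex_of_real (ln (cmod (z t))) + \<i> * complex_of_real (\<phi> t)"
    using Ln_exp[of "complex_of_real (ln (cmod (z t))) + \<i> * complex_of_real (\<phi> t)"]
    by simp
  then have "\<bar>\<phi> t - Im (z t)\<bar> = \<bar>Im (Ln (1 + (z t - 1)) - (z t - 1))\<bar>"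
    by simp
  also have "\<dots> \<le> cmod (Ln (1 + (z t - 1)) - (z t - 1))"
    by (rule abs_Im_le_cmod)
  also have "\<dots> \<le> (cmod (z t - 1))\<^sup>2 / (1 - cmod (z t - 1))"
    using near[OF t] by (intro Ln_approx_linear) simp
  also have "\<dots> \<le> (cmod (z t - 1))\<^sup>2 / (1 / 2)"
    using near[OF t] by (intro divide_left_mono) auto
  finally show ?thesis by simp
qed

section \<open>Convergence of laws of close processes\<close>

text \<open>A bounded continuous functional \<open>h\<close> on path space need not be uniformly continuous. The paths
  near which \<open>h\<close> varies by at most \<open>r\<close> at a given scale take the place of uniform continuity. To
  make their set open, the scale is required to be strictly larger than \<open>d\<close> and the variation is
  measured between two arbitrary paths of the neighbourhood, rather than against its centre.\<close>

lemma openin_paths_small_oscillation: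
  assumes "T > 0"
  shows "openin path_topology {f \<in> continuous_paths. \<exists>e>d. \<forall>g\<in>continuous_paths. \<forall>g'\<in>continuous_paths.
    (\<forall>t\<in>{0..T}. \<bar>g t - f t\<bar> < e) \<and> (\<forall>t\<in>{0..T}. \<bar>g' t - f t\<bar> < e) \<longrightarrow> \<bar>h g - h g'\<bar> \<le> (r::real)}"
    (is "openin _ {f \<in> _. \<exists>e>d. ?osc f e}")
  unfolding openin_path_topology
proof (intro conjI ballI)
  fix f assume f: "f \<in> {f \<in> continuous_paths. \<exists>e>d. ?osc f e}"
  then obtain e where e: "e > d" "?osc f e" by blast
  have "\<exists>e'>d. ?osc f' e'" if near: "\<forall>t\<in>{0..T}. \<bar>f' t - f t\<bar> < (e - d) / 2" for f'
  proof (intro exI conjI)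
    have tri: "\<forall>t\<in>{0..T}. \<bar>g t - f t\<bar> < e" if "\<forall>t\<in>{0..T}. \<bar>g t - f' t\<bar> < (e + d) / 2" for g
    proof
      fix t assume t: "t \<in> {0..T}"
      have "\<bar>g t - f t\<bar> \<le> \<bar>g t - f' t\<bar> + \<bar>f' t - f t\<bar>" by simp
      also have "\<dots> < (e + d) / 2 + (e - d) / 2"
        using near that t by (intro add_strict_mono) auto
      finally show "\<bar>g t - f t\<bar> < e" by (simp add: field_simps)
    qed
    show "?osc f' ((e + d) / 2)" using e(2) tri by blast
  qed (use e in simp)
  then show "\<exists>T>0. \<exists>e>0. \<forall>g\<in>continuous_paths. (\<forall>t\<in>{0..T}. \<bar>g t - f t\<bar> < e) \<longrightarrow>
      g \<in> {f \<in> continuous_paths. \<exists>e>d. ?osc f e}"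
    using e(1) \<open>T > 0\<close> by (intro exI[of _ T] conjI exI[of _ "(e - d) / 2"]) auto
qed auto

text \<open>The bound is strict so that the set is open.\<close>

lemma openin_paths_bounded:
  assumes "T > 0"
  shows "openin path_topology {f \<in> continuous_paths. \<exists>b<a. \<forall>t\<in>{0..T}. \<bar>f t\<bar> \<le> b}"
    (is "openin _ ?A")
  unfolding openin_path_topology
proof (intro conjI ballI)
  fix f assume "f \<in> {f \<in> continuous_paths. \<exists>b<a. \<forall>t\<in>{0..T}. \<bar>f t\<bar> \<le> b}"
  then obtain b where b: "b < a" "\<And>t. t \<in> {0..T} \<Longrightarrow> \<bar>f t\<bar> \<le> b" by blast
  have "\<exists>b<a. \<forall>t\<in>{0..T}. \<bar>g t\<bar> \<le> b" if "\<forall>t\<in>{0..T}. \<bar>g t - f t\<bar> < (a - b) / 2" for g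
  proof (intro exI[of _ "(a + b) / 2"] conjI ballI)
    fix t assume t: "t \<in> {0..T}"
    have "\<bar>g t - f t\<bar> < (a - b) / 2" using that t by blast
    with b(2)[OF t] show "\<bar>g t\<bar> \<le> (a + b) / 2" by (simp add: field_simps abs_if split: if_splits)
  qed (use b in simp)
  then show "\<exists>T>0. \<exists>e>0. \<forall>g\<in>continuous_paths. (\<forall>t\<in>{0..T}. \<bar>g t - f t\<bar> < e) \<longrightarrow>
      g \<in> ?A"
    using b(1) \<open>T > 0\<close> by (intro exI[of _ T] conjI exI[of _ "(a - b) / 2"]) auto
qed auto

lemma (in prob_space) increasing_open_sets_exhaust:
  assumes "sets M = sets (borel_of T)" and "\<And>k::nat. openin T (A k)" and "incseq A"
    and "(\<Union>k. A k) = topspace T" and "\<eta> > 0"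
  shows "eventually (\<lambda>k. prob (A k) > 1 - \<eta>) sequentially"
proof -
  have "space M = topspace T"
    using sets_eq_imp_space_eq[OF assms(1)] by (simp add: space_borel_of)
  have "(\<lambda>k. prob (A k)) \<longlonglongrightarrow> prob (\<Union>k. A k)"
    using assms by (intro finite_Lim_measure_incseq) (auto intro: openin_in_sets_borel_of)
  then have "(\<lambda>k. prob (A k)) \<longlonglongrightarrow> 1"
    using assms(4) \<open>space M = topspace T\<close> by (metis prob_space)
  then show ?thesis
    using \<open>\<eta> > 0\<close> by (intro order_tendstoD(1)) auto
qed

text \<open>By continuity every path lies in one of the open sets of small oscillation as \<open>T\<close> grows and
  \<open>d\<close> shrinks, so under a fixed law one of these sets carries almost all of the mass.\<close>

lemma continuous_functional_oscillation:
  assumes "prob_space \<mu>" and M: "sets \<mu> = sets (borel_of path_topology)"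
    and h: "continuous_map path_topology euclideanreal h" and "r > 0" "\<eta> > 0"
  obtains T d U where "T > 0" "d > 0" "openin path_topology U" "measure \<mu> U > 1 - \<eta>"
    "\<And>f g. f \<in> U \<Longrightarrow> g \<in> continuous_paths \<Longrightarrow> (\<And>t. t \<in> {0..T} \<Longrightarrow> \<bar>g t - f t\<bar> < d) \<Longrightarrow> \<bar>h g - h f\<bar> \<le> r"
proof -
  interpret prob_space \<mu> by fact
  define osc where "osc = (\<lambda>T f e. \<forall>g\<in>continuous_paths. \<forall>g'\<in>continuous_paths.
    (\<forall>t\<in>{0..T}. \<bar>g t - f t\<bar> < e) \<and> (\<forall>t\<in>{0..T}. \<bar>g' t - f t\<bar> < e) \<longrightarrow> \<bar>h g - h g'\<bar> \<le> r)"
  define A where "A = (\<lambda>k. {f \<in> continuous_paths. \<exists>e>1 / real (Suc k). osc (real (Suc k)) f e})"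
  have osc_mono: "osc T' f e" if "osc T f e" "T \<le> T'" for T T' f e
    using that unfolding osc_def by (meson atLeastAtMost_iff order_trans)
  have "eventually (\<lambda>k. measure \<mu> (A k) > 1 - \<eta>) sequentially"
  proof (rule increasing_open_sets_exhaust[OF M])
    show "openin path_topology (A k)" for k
      unfolding A_def osc_def by (rule openin_paths_small_oscillation) simp
    show "incseq A"
    proof (rule incseq_SucI, rule subsetI)
      fix k f assume "f \<in> A k"
      then obtain e where "f \<in> continuous_paths" "e > 1 / real (Suc k)" "osc (real (Suc k)) f e"
        by (auto simp: A_def)
      moreover have "1 / real (Suc (Suc k)) \<le> 1 / real (Suc k)"
        by (intro divide_left_mono) auto
      ultimately show "f \<in> A (Suc k)"
        unfolding A_def
        by (intro CollectI conjI exI[of _ e]) (auto intro: osc_mono)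
    qed
    show "(\<Union>k. A k) = topspace path_topology"
    proof (intro subset_antisym subsetI)
      fix f assume "f \<in> topspace path_topology"
      then have f: "f \<in> continuous_paths" by (simp add: topspace_path_topology)
      have "openin path_topology {g \<in> topspace path_topology. h g \<in> ball (h f) (r / 2)}"
        using h by (intro openin_continuous_map_preimage) auto
      then obtain T e where Te: "T > 0" "e > 0"
        "\<And>g. g \<in> continuous_paths \<Longrightarrow> (\<forall>t\<in>{0..T}. \<bar>g t - f t\<bar> < e) \<Longrightarrow> \<bar>h f - h g\<bar> < r / 2"
        using f \<open>r > 0\<close> unfolding openin_path_topology
        by (auto simp: topspace_path_topology dist_real_def)
      have osc: "osc T f e"
        unfolding osc_def
      proof (intro ballI impI)
        fix g g' assume *: "g \<in> continuous_paths" "g' \<in> continuous_paths"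
          "(\<forall>t\<in>{0..T}. \<bar>g t - f t\<bar> < e) \<and> (\<forall>t\<in>{0..T}. \<bar>g' t - f t\<bar> < e)"
        then have "\<bar>h f - h g\<bar> < r / 2" "\<bar>h f - h g'\<bar> < r / 2"
          using Te(3) by blast+
        then show "\<bar>h g - h g'\<bar> \<le> r" by linarith
      qed
      (* One index k controls both parameters: the time horizon k + 1 and the scale 1 / (k + 1). *)
      obtain k :: nat where k: "real k > max T (1 / e)"
        using reals_Archimedean2 by blast
      have "1 / real (Suc k) < e"
        using k Te(2) by (simp add: field_simps)
      moreover have "osc (real (Suc k)) f e"
        using k by (intro osc_mono[OF osc]) simp
      ultimately show "f \<in> (\<Union>k. A k)" using f by (auto simp: A_def)
    qed (auto simp: A_def topspace_path_topology)
  qed fact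
  then obtain k where k: "measure \<mu> (A k) > 1 - \<eta>"
    by (auto simp: eventually_sequentially)
  show thesis
  proof (rule that[of "real (Suc k)" "1 / real (Suc k)" "A k"])
    show "openin path_topology (A k)"
      unfolding A_def osc_def by (rule openin_paths_small_oscillation) simp
    fix f g assume f: "f \<in> A k" and g: "g \<in> continuous_paths"
      and near: "\<And>t. t \<in> {0..real (Suc k)} \<Longrightarrow> \<bar>g t - f t\<bar> < 1 / real (Suc k)"
    obtain e where e: "f \<in> continuous_paths" "e > 1 / real (Suc k)" "osc (real (Suc k)) f e"
      using f by (auto simp: A_def)
    have "e > 0" using e(2) by (rule order.strict_trans[rotated]) simp
    moreover have "\<forall>t\<in>{0..real (Suc k)}. \<bar>g t - f t\<bar> < e"
      using near e(2) by (meson order.strict_trans)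
    ultimately show "\<bar>h g - h f\<bar> \<le> r"
      using e g unfolding osc_def by auto
  qed (use k in auto)
qed

text \<open>A continuous path is bounded on \<open>{0..T}\<close>, so the open sets of paths with an integer bound
  exhaust path space.\<close>

lemma paths_bounded_in_probability:
  assumes "prob_space \<mu>" and M: "sets \<mu> = sets (borel_of path_topology)" and "T > 0" "\<eta> > 0"
  obtains V a where "openin path_topology V" "measure \<mu> V > 1 - \<eta>"
    "\<And>f t. f \<in> V \<Longrightarrow> t \<in> {0..T} \<Longrightarrow> \<bar>f t\<bar> \<le> a"
proof -
  interpret prob_space \<mu> by fact
  define A where "A = (\<lambda>k. {f \<in> continuous_paths. \<exists>b<real (Suc k). \<forall>t\<in>{0..T}. \<bar>f t\<bar> \<le> b})"
  have op: "openin path_topology (A k)" for k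
    unfolding A_def using \<open>T > 0\<close> by (rule openin_paths_bounded)
  have "eventually (\<lambda>k. measure \<mu> (A k) > 1 - \<eta>) sequentially"
  proof (rule increasing_open_sets_exhaust[OF M op])
    show "incseq A"
    proof (rule incseq_SucI, rule subsetI)
      fix k f assume "f \<in> A k"
      then obtain b where "f \<in> continuous_paths" "b < real (Suc k)" "\<forall>t\<in>{0..T}. \<bar>f t\<bar> \<le> b"
        by (auto simp: A_def)
      then show "f \<in> A (Suc k)"
        unfolding A_def by (intro CollectI conjI exI[of _ b]) auto
    qed
    show "(\<Union>k. A k) = topspace path_topology"
    proof (intro subset_antisym subsetI)
      fix f assume "f \<in> topspace path_topology"
      then have f: "f \<in> continuous_paths" by (simp add: topspace_path_topology)
      then have "continuous_on {0..T} f"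
        by (auto simp: continuous_paths_def elim: continuous_on_subset)
      then have "bounded (f ` {0..T})"
        by (intro compact_imp_bounded compact_continuous_image) auto
      then obtain b where b: "\<forall>t\<in>{0..T}. \<bar>f t\<bar> \<le> b"
        by (auto simp: bounded_iff)
      obtain k :: nat where "real k > b" using reals_Archimedean2 by blast
      then have "b < real (Suc k)" by simp
      then show "f \<in> (\<Union>k. A k)" using f b by (auto simp: A_def)
    qed (auto simp: A_def topspace_path_topology)
  qed fact
  then obtain k where k: "measure \<mu> (A k) > 1 - \<eta>"
    by (auto simp: eventually_sequentially)
  show thesis
  proof (rule that[of "A k" "real (Suc k)"])
    show "\<bar>f t\<bar> \<le> real (Suc k)" if "f \<in> A k" "t \<in> {0..T}" for f t
      using that unfolding A_def by fastforce
  qed (use k op in auto)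
qed

lemma borel_measurable_continuous_functional:
  assumes "continuous_process M X" and h: "continuous_map path_topology euclideanreal h"
  shows "(\<lambda>\<omega>. h (sample_path X \<omega>)) \<in> borel_measurable (completion M)"
    and "(\<integral>x. h x \<partial>path_law M X) = (\<integral>\<omega>. h (sample_path X \<omega>) \<partial>completion M)"
  using sample_path_measurable[OF assms(1)] continuous_map_borel_measurable[OF h]
  by (auto simp: path_law_def integral_distr intro: measurable_compose)

text \<open>Suppose that all \<open>Y i\<close> have one and the same law \<open>\<mu>\<close>. The set \<open>U\<close> of paths near which \<open>h\<close>
  oscillates little can then be chosen once for all \<open>i\<close>. Outside an event of small probability the
  path of \<open>Y i\<close> lies in \<open>U\<close> and that of \<open>X i\<close> is close to it, so \<open>h\<close> changes little; on the
  exceptional event its change is bounded by twice the bound of \<open>h\<close>.\<close>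

lemma weakly_converges_if_close_in_probability:
  fixes X Y :: "'i \<Rightarrow> real \<Rightarrow> 'a \<Rightarrow> real"
  assumes "prob_space M"
    and Xc: "\<forall>\<^sub>F i in F. continuous_process M (X i)"
    and Yc: "\<forall>\<^sub>F i in F. continuous_process M (Y i) \<and> path_law M (Y i) = \<mu>"
    and \<mu>: "prob_space \<mu>" "sets \<mu> = sets (borel_of path_topology)"
    and close: "\<And>T d \<eta>. T > 0 \<Longrightarrow> d > 0 \<Longrightarrow> \<eta> > 0 \<Longrightarrow>
      \<forall>\<^sub>F i in F. \<exists>G\<in>sets (completion M). measure (completion M) G \<ge> 1 - \<eta> \<and>
        (AE \<omega> in completion M. \<omega> \<in> G \<longrightarrow>
          (\<forall>t\<in>{0..T}. \<bar>sample_path (X i) \<omega> t - sample_path (Y i) \<omega> t\<bar> < d))"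
  shows "weakly_converges path_topology (\<lambda>i. path_law M (X i)) \<mu> F"
  unfolding weakly_converges_def
proof (intro allI impI)
  interpret M: prob_space M by fact
  interpret P: prob_space "completion M" by (rule M.prob_space_completion)
  fix h assume "continuous_map path_topology euclideanreal h \<and> bounded (h ` topspace path_topology)"
  then have h: "continuous_map path_topology euclideanreal h"
    and "bounded (h ` continuous_paths)"
    by (auto simp: topspace_path_topology)
  then obtain b where "b > 0" and b: "\<And>f. f \<in> continuous_paths \<Longrightarrow> \<bar>h f\<bar> \<le> b"
    by (auto simp: bounded_pos)
  show "((\<lambda>i. \<integral>x. h x \<partial>path_law M (X i)) \<longlongrightarrow> (\<integral>x. h x \<partial>\<mu>)) F"
  proof (rule tendstoI)
    fix e :: real assume "e > 0"
    (* Two exceptional events of probability at most \<eta> each, on which h changes by at most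
       2 * b, contribute e / 2 in total; the oscillation on U contributes e / 4. *)
    define \<eta> where "\<eta> = e / (8 * b)"
    have "\<eta> > 0" using \<open>e > 0\<close> \<open>b > 0\<close> by (simp add: \<eta>_def)
    have "e / 4 > 0" using \<open>e > 0\<close> by simp
    obtain T d U where T: "T > 0" "d > 0" and U: "openin path_topology U" "measure \<mu> U > 1 - \<eta>"
      and osc: "\<And>f g. f \<in> U \<Longrightarrow> g \<in> continuous_paths \<Longrightarrow>
        (\<And>t. t \<in> {0..T} \<Longrightarrow> \<bar>g t - f t\<bar> < d) \<Longrightarrow> \<bar>h g - h f\<bar> \<le> e / 4"
      using continuous_functional_oscillation[OF \<mu> h \<open>e / 4 > 0\<close> \<open>\<eta> > 0\<close>] by blast
    show "\<forall>\<^sub>F i in F. dist (\<integral>x. h x \<partial>path_law M (X i)) (\<integral>x. h x \<partial>\<mu>) < e"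
      using Xc Yc close[OF T \<open>\<eta> > 0\<close>]
    proof eventually_elim
      case (elim i)
      let ?X = "sample_path (X i)" and ?Y = "sample_path (Y i)"
      obtain G where G: "G \<in> P.events" "P.prob G \<ge> 1 - \<eta>"
        and near: "AE \<omega> in completion M. \<omega> \<in> G \<longrightarrow> (\<forall>t\<in>{0..T}. \<bar>?X \<omega> t - ?Y \<omega> t\<bar> < d)"
        using elim(3) by blast
      have Y: "?Y \<in> measurable (completion M) (borel_of path_topology)"
        using elim(2) by (intro sample_path_measurable) simp
      define V where "V = ?Y -` U \<inter> space M"
      have V: "V \<in> P.events"
        using measurable_sets[OF Y openin_in_sets_borel_of[OF U(1)]] by (simp add: V_def)
      have "\<mu> = distr (completion M) (borel_of path_topology) ?Y"
        using elim(2) by (simp add: path_law_def)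
      then have "P.prob V > 1 - \<eta>"
        using measure_distr[OF Y openin_in_sets_borel_of[OF U(1)]] U(2) by (simp add: V_def)
      define N where "N = (space M - G) \<union> (space M - V)"
      have N: "N \<in> P.events"
        using G V sets.top[of "completion M"] by (auto simp: N_def)
      have "P.prob N \<le> P.prob (space M - G) + P.prob (space M - V)"
        unfolding N_def using G V by (intro measure_Un_le) auto
      also have "\<dots> \<le> 2 * \<eta>"
        using P.prob_compl[OF G(1)] P.prob_compl[OF V] G(2) \<open>P.prob V > 1 - \<eta>\<close> by simp
      finally have probN: "P.prob N \<le> 2 * \<eta>" .
      have hX: "(\<lambda>\<omega>. h (?X \<omega>)) \<in> borel_measurable (completion M)"
        and hY: "(\<lambda>\<omega>. h (?Y \<omega>)) \<in> borel_measurable (completion M)"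
        using elim h by (auto intro: borel_measurable_continuous_functional)
      have bX: "\<bar>h (?X \<omega>)\<bar> \<le> b" and bY: "\<bar>h (?Y \<omega>)\<bar> \<le> b" for \<omega>
        by (auto intro: b sample_path_in_continuous_paths)
      have iX: "integrable (completion M) (\<lambda>\<omega>. h (?X \<omega>))"
        and iY: "integrable (completion M) (\<lambda>\<omega>. h (?Y \<omega>))"
        using hX hY bX bY by (auto intro!: P.integrable_const_bound[where B = b])
      have "\<bar>(\<integral>\<omega>. h (?X \<omega>) \<partial>completion M) - (\<integral>\<omega>. h (?Y \<omega>) \<partial>completion M)\<bar> =
          \<bar>\<integral>\<omega>. h (?X \<omega>) - h (?Y \<omega>) \<partial>completion M\<bar>"
        using iX iY by simp
      also have "\<dots> \<le> (\<integral>\<omega>. \<bar>h (?X \<omega>) - h (?Y \<omega>)\<bar> \<partial>completion M)"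
        using integral_norm_bound[of "completion M" "\<lambda>\<omega>. h (?X \<omega>) - h (?Y \<omega>)"] by simp
      also have "\<dots> \<le> (\<integral>\<omega>. e / 4 + 2 * b * indicator N \<omega> \<partial>completion M)"
      proof (rule integral_mono_AE)
        show "AE \<omega> in completion M. \<bar>h (?X \<omega>) - h (?Y \<omega>)\<bar> \<le> e / 4 + 2 * b * indicator N \<omega>"
          using near AE_space
        proof eventually_elim
          case (elim \<omega>)
          show ?case
          proof (cases "\<omega> \<in> N")
            case True
            have "\<bar>h (?X \<omega>) - h (?Y \<omega>)\<bar> \<le> 2 * b"
              using bX[of \<omega>] bY[of \<omega>] by linarith
            then show ?thesis using True \<open>e > 0\<close> by simp
          next
            case False
            then have "?Y \<omega> \<in> U" "\<omega> \<in> G"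
              using elim(2) by (auto simp: N_def V_def)
            then have "\<bar>h (?X \<omega>) - h (?Y \<omega>)\<bar> \<le> e / 4"
              by (intro osc) (use elim(1) sample_path_in_continuous_paths in auto)
            then show ?thesis using False by simp
          qed
        qed
      qed (use iX iY N in \<open>auto intro!: Bochner_Integration.integrable_add integrable_real_indicator P.emeasure_finite integrable_mult_right simp: less_top[symmetric]\<close>)
      also have "\<dots> = e / 4 + 2 * b * P.prob N"
        using N P.prob_space sets.sets_into_space[OF N]
        by (simp add: P.emeasure_finite less_top[symmetric] Int_absorb2)
      also have "\<dots> \<le> e / 4 + 2 * b * (2 * \<eta>)"
        using probN \<open>b > 0\<close> by (intro add_left_mono mult_left_mono) auto
      also have "\<dots> = e / 4 + e / 2"
        using \<open>b > 0\<close> by (simp add: \<eta>_def)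
      also have "\<dots> < e" using \<open>e > 0\<close> by simp
      finally show ?case
        using elim h borel_measurable_continuous_functional(2)[OF _ h, of M]
        by (auto simp: dist_real_def)
    qed
  qed
qed

section \<open>The rescaled winding process\<close>

text \<open>If the rescaled coordinates are bounded by \<open>a\<close>, then \<open>z - 1\<close> has size at most \<open>2 * a * sqrt c\<close>
  on \<open>{0..c * T}\<close>. The error in replacing the angle by \<open>Im z\<close> is quadratic in this size, that is
  of order \<open>c\<close>, and the rescaling only multiplies it by \<open>1 / sqrt c\<close>.\<close>

lemma rescaled_winding_near_imaginary_part:
  fixes \<phi> :: "real \<Rightarrow> real" and z :: "real \<Rightarrow> complex"
  assumes c: "c > 0" "2 * a * sqrt c \<le> 1 / 2"
    and cont: "continuous_on {0..} \<phi>" and "\<phi> 0 = 0"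
    and arg: "\<And>t. t \<ge> 0 \<Longrightarrow> exp (\<i> * complex_of_real (\<phi> t)) = z t / complex_of_real (cmod (z t))"
    and Re: "\<And>t. t \<in> {0..T} \<Longrightarrow> \<bar>c powr (-1/2) * (Re (z (c * t)) - 1)\<bar> \<le> a"
    and Im: "\<And>t. t \<in> {0..T} \<Longrightarrow> \<bar>c powr (-1/2) * Im (z (c * t))\<bar> \<le> a"
    and t: "t \<in> {0..T}"
  shows "\<bar>c powr (-1/2) * \<phi> (c * t) - c powr (-1/2) * Im (z (c * t))\<bar> \<le> 8 * a\<^sup>2 * sqrt c"
proof -
  have scale: "c powr (-1/2) = 1 / sqrt c"
    using c by (simp add: powr_minus_divide powr_half_sqrt)
  have dist: "cmod (z (c * u) - 1) \<le> 2 * a * sqrt c" if u: "u \<in> {0..T}" for u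
  proof -
    have "\<bar>Re (z (c * u)) - 1\<bar> \<le> a * sqrt c" "\<bar>Im (z (c * u))\<bar> \<le> a * sqrt c"
      using Re[OF u, unfolded scale] Im[OF u, unfolded scale] c
      by (simp_all add: abs_mult pos_divide_le_eq)
    then show ?thesis using cmod_le[of "z (c * u) - 1"] by simp
  qed
  have "\<bar>\<phi> (c * t) - Im (z (c * t))\<bar> \<le> 2 * (cmod (z (c * t) - 1))\<^sup>2"
  proof (rule winding_angle_near_start[of "c * T"])
    show "continuous_on {0..c * T} \<phi>" using cont by (rule continuous_on_subset) auto
    show "cmod (z s - 1) \<le> 1 / 2" if "s \<in> {0..c * T}" for s
      using dist[of "s / c"] that c by (auto simp: field_simps)
  qed (use t c arg \<open>\<phi> 0 = 0\<close> in auto)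
  also have "\<dots> \<le> 2 * (2 * a * sqrt c)\<^sup>2"
    using dist[OF t] by (intro mult_left_mono power_mono) auto
  also have "\<dots> = 8 * a\<^sup>2 * c"
    using c by (simp add: power_mult_distrib)
  finally have "\<bar>\<phi> (c * t) - Im (z (c * t))\<bar> / sqrt c \<le> 8 * a\<^sup>2 * c / sqrt c"
    using c by (intro divide_right_mono) auto
  moreover have "8 * a\<^sup>2 * c / sqrt c = 8 * a\<^sup>2 * sqrt c"
    using c by (simp add: real_div_sqrt flip: times_divide_eq_right)
  moreover have "\<bar>1 / sqrt c * \<phi> (c * t) - 1 / sqrt c * Im (z (c * t))\<bar> =
      \<bar>\<phi> (c * t) - Im (z (c * t))\<bar> / sqrt c"
    using c by (simp add: abs_divide flip: diff_divide_distrib)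
  ultimately show ?thesis unfolding scale by linarith
qed

text \<open>The processes \<open>R c\<close> and \<open>I c\<close> are the rescaled coordinates of \<open>Z - 1\<close>. Each of them has the
  law of \<open>\<gamma>\<close> for every \<open>c\<close>, so one bound \<open>a\<close> on their paths over \<open>{0..T}\<close> holds with probability
  close to one uniformly in \<open>c\<close>. Once the paths are bounded by \<open>a\<close>, the distance between the
  rescaled winding and \<open>I c\<close> is at most a deterministic multiple of \<open>sqrt c\<close>.\<close>

theorem theorem6p1:
  fixes M :: "'a measure" and N :: "'b measure"
    and Z :: "real \<Rightarrow> 'a \<Rightarrow> complex"
    and \<theta> :: "real \<Rightarrow> 'a \<Rightarrow> real"
    and \<gamma> :: "real \<Rightarrow> 'b \<Rightarrow> real"
  assumes "planar_brownian_motion M 1 Z"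
    and "winding_process M Z \<theta>"
    and "standard_brownian_motion N \<gamma>"
  shows "process_converges_in_distribution
           M (\<lambda>c t \<omega>. c powr (-1/2) * \<theta> (c * t) \<omega>) N \<gamma> (at_right 0)"
proof -
  define R where "R = (\<lambda>c t \<omega>. c powr (-1/2) * (Re (Z (c * t) \<omega>) - 1))"
  define I where "I = (\<lambda>c t \<omega>. c powr (-1/2) * (Im (Z (c * t) \<omega>) - 0))"
  define W where "W = (\<lambda>c t \<omega>. c powr (-1/2) * \<theta> (c * t) \<omega>)"
  define \<mu> where "\<mu> = path_law N \<gamma>"
  interpret M: prob_space M
    using assms(1) by (simp add: planar_brownian_motion_def brownian_motion_def)
  interpret P: prob_space "completion M" by (rule M.prob_space_completion)
  interpret N: prob_space N using assms(3) by (simp add: brownian_motion_def)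
  have contp: "continuous_process L X" if "standard_brownian_motion L X" for L :: "'c measure" and X
    using that by (simp add: brownian_motion_def)
  have \<gamma>: "continuous_process N \<gamma>" using contp[OF assms(3)] .
  have BM: "standard_brownian_motion M (R c)" "standard_brownian_motion M (I c)" if "c > 0" for c
    using assms(1) brownian_motion_scaling[OF _ that, of M 1 "\<lambda>t \<omega>. Re (Z t \<omega>)"]
      brownian_motion_scaling[OF _ that, of M 0 "\<lambda>t \<omega>. Im (Z t \<omega>)"]
    unfolding planar_brownian_motion_def R_def I_def by simp_all
  have law: "path_law M (R c) = \<mu>" "path_law M (I c) = \<mu>" if "c > 0" for c
    unfolding \<mu>_def using BM[OF that] assms(3) by (auto intro!: brownian_motion_path_law_unique)
  have \<mu>: "prob_space \<mu>" "sets \<mu> = sets (borel_of path_topology)"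
    unfolding \<mu>_def path_law_def
    by (auto intro!: prob_space.prob_space_distr N.prob_space_completion sample_path_measurable \<gamma>)
  have W: "continuous_process M (W c)" if "c > 0" for c
    using assms(2) that continuous_process_rescaled[of M \<theta> c "c powr (-1/2)" 0]
    unfolding W_def winding_process_def by simp
  have pos: "\<forall>\<^sub>F c in at_right 0. (c :: real) > 0"
    by (simp add: eventually_at_right_less)
  have "weakly_converges path_topology (\<lambda>c. path_law M (W c)) \<mu> (at_right 0)"
  proof (rule weakly_converges_if_close_in_probability[where Y = I, OF M.prob_space_axioms _ _ \<mu>])
    show "\<forall>\<^sub>F c in at_right 0. continuous_process M (W c)"
      using pos by eventually_elim (rule W)
    show "\<forall>\<^sub>F c in at_right 0. continuous_process M (I c) \<and> path_law M (I c) = \<mu>"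
      using pos by eventually_elim (auto intro: contp BM law)
    fix T d \<eta> :: real assume "T > 0" "d > 0" "\<eta> > 0"
    then have "\<eta> / 2 > 0" by simp
    then obtain V a where V: "openin path_topology V" "measure \<mu> V > 1 - \<eta> / 2"
      and bound: "\<And>f t. f \<in> V \<Longrightarrow> t \<in> {0..T} \<Longrightarrow> \<bar>f t\<bar> \<le> a"
      using paths_bounded_in_probability[OF \<mu> \<open>T > 0\<close>] by blast
    have "((\<lambda>c. 8 * a\<^sup>2 * sqrt c) \<longlongrightarrow> 8 * a\<^sup>2 * sqrt 0) (at_right 0)"
      "((\<lambda>c. 2 * a * sqrt c) \<longlongrightarrow> 2 * a * sqrt 0) (at_right 0)"
      by (intro tendsto_intros)+
    then have "\<forall>\<^sub>F c in at_right 0. 8 * a\<^sup>2 * sqrt c < d" "\<forall>\<^sub>F c in at_right 0. 2 * a * sqrt c < 1 / 2"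
      using \<open>d > 0\<close> by (simp_all only: order_tendstoD(2) real_sqrt_zero mult_zero_right)
    with pos show "\<forall>\<^sub>F c in at_right 0. \<exists>G\<in>P.events. P.prob G \<ge> 1 - \<eta> \<and>
        (AE \<omega> in completion M. \<omega> \<in> G \<longrightarrow>
          (\<forall>t\<in>{0..T}. \<bar>sample_path (W c) \<omega> t - sample_path (I c) \<omega> t\<bar> < d))"
    proof eventually_elim
      case (elim c)
      let ?E = "\<lambda>X. sample_path X -` V \<inter> space M"
      have E: "?E X \<in> P.events" "P.prob (?E X) > 1 - \<eta> / 2"
        if X: "continuous_process M X" "path_law M X = \<mu>" for X
        using measurable_sets[OF sample_path_measurable[OF X(1)] openin_in_sets_borel_of[OF V(1)]]
          measure_distr[OF sample_path_measurable[OF X(1)] openin_in_sets_borel_of[OF V(1)]] V(2) X(2)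
        by (auto simp: path_law_def)
      note ER = E[OF contp[OF BM(1)[OF elim(1)]] law(1)[OF elim(1)]]
        and EI = E[OF contp[OF BM(2)[OF elim(1)]] law(2)[OF elim(1)]]
      show ?case
      proof (intro bexI conjI)
        show "?E (R c) \<inter> ?E (I c) \<in> P.events" using ER EI by blast
        have "P.prob (space M - ?E (R c) \<inter> ?E (I c)) \<le>
            P.prob ((space M - ?E (R c)) \<union> (space M - ?E (I c)))"
          using ER EI sets.top[of "completion M"] by (intro P.finite_measure_mono) auto
        also have "\<dots> \<le> P.prob (space M - ?E (R c)) + P.prob (space M - ?E (I c))"
          using ER EI sets.top[of "completion M"] by (intro measure_Un_le) auto
        finally show "1 - \<eta> \<le> P.prob (?E (R c) \<inter> ?E (I c))"
          using P.prob_compl[of "?E (R c)"] P.prob_compl[of "?E (I c)"] ER EI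
            P.prob_compl[of "?E (R c) \<inter> ?E (I c)"] by auto
        have "AE \<omega> in M. continuous_on {0..} (\<lambda>t. \<theta> t \<omega>)"
          and "AE \<omega> in M. \<theta> 0 \<omega> = 0 \<and> (\<forall>t\<ge>0. exp (\<i> * complex_of_real (\<theta> t \<omega>)) =
            Z t \<omega> / complex_of_real (cmod (Z t \<omega>)))"
          using assms(2) by (auto simp: winding_process_def continuous_process_def)
        then have "AE \<omega> in M. \<omega> \<in> ?E (R c) \<inter> ?E (I c) \<longrightarrow>
          (\<forall>t\<in>{0..T}. \<bar>sample_path (W c) \<omega> t - sample_path (I c) \<omega> t\<bar> < d)"
          using AE_sample_path[OF W[OF elim(1)]] AE_sample_path[OF contp[OF BM(1)[OF elim(1)]]]
            AE_sample_path[OF contp[OF BM(2)[OF elim(1)]]]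
        proof eventually_elim
          case \<omega>: (elim \<omega>)
          show ?case
          proof (intro impI ballI)
            fix t assume good: "\<omega> \<in> ?E (R c) \<inter> ?E (I c)" and t: "t \<in> {0..T}"
            have R: "\<bar>R c s \<omega>\<bar> \<le> a" and I: "\<bar>I c s \<omega>\<bar> \<le> a" if s: "s \<in> {0..T}" for s
              using bound[of "sample_path (R c) \<omega>" s] bound[of "sample_path (I c) \<omega>" s] good s \<omega>(4,5)
              by auto
            have "\<bar>W c t \<omega> - I c t \<omega>\<bar> \<le> 8 * a\<^sup>2 * sqrt c"
              using rescaled_winding_near_imaginary_part[of c a "\<lambda>t. \<theta> t \<omega>" "\<lambda>t. Z t \<omega>" T t]
                elim \<omega>(1,2) R I t by (simp add: W_def I_def R_def)
            then show "\<bar>sample_path (W c) \<omega> t - sample_path (I c) \<omega> t\<bar> < d"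
              using elim(2) t \<omega>(3,5) by simp
          qed
        qed
        then show "AE \<omega> in completion M. \<omega> \<in> ?E (R c) \<inter> ?E (I c) \<longrightarrow>
          (\<forall>t\<in>{0..T}. \<bar>sample_path (W c) \<omega> t - sample_path (I c) \<omega> t\<bar> < d)"
          by (rule AE_completion)
      qed
    qed
  qed
  moreover have "\<forall>\<^sub>F c in at_right 0. random_path M (W c)"
    using pos by eventually_elim (intro random_path_if_continuous_process W)
  ultimately show ?thesis
    using random_path_if_continuous_process[OF \<gamma>]
    unfolding process_converges_in_distribution_def W_def \<mu>_def by blast
qed

end
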